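(* Let $h_1,\dots,h_{N_h}$ be a collection of given polynomials and let $\epsilon_{cbf}>0$ be a constant. Suppose that for every $p\in\mathcal{P}$ and every $\mathbf{x}\in\mathcal{X}_p$ there exists $\mathbf{u}\in\mathrm{Int}(\mathcal{U})$ such that (C2-1) $L_{\mathbf{f}}h_p(\mathbf{x})+L_{\mathbf{G}}h_p(\mathbf{x})\mathbf{u}+\kappa h_p(\mathbf{x})\ge\epsilon_{cbf}$. Then any switching signal $\sigma(t)$ following Switching Strategy II satisfies: (P1-1) $\sigma(t)$ is right continuous, piecewise constant, and has only a finite number of switches in any finite time horizon $[0,T]$; and (P1-2) for all $t\ge 0$, $h_{\sigma(t)}(\mathbf{x}(t))\ge 0$ and there exists $\mathbf{u}\in\mathrm{Int}(\mathcal{U})$ with $L_{\mathbf{f}}h_{\sigma(t)}(\mathbf{x}(t))+L_{\mathbf{G}}h_{\sigma(t)}(\mathbf{x}(t))\mathbf{u}>-\kappa h_{\sigma(t)}(\mathbf{x}(t))$.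
   Context: System: $\dot{\mathbf{x}}(t)=\mathbf{f}(\mathbf{x}(t))+\mathbf{G}(\mathbf{x}(t))\mathbf{u}(t)$, state $\mathbf{x}(t)\in\mathcal{X}\subseteq\mathbb{R}^{n_x}$, control $\mathbf{u}(t)\in\mathcal{U}\subseteq\mathbb{R}^{n_u}$; $\mathbf{f}$ and $\mathbf{G}$ are polynomial in $\mathbf{x}$. The admissible control set is $\mathcal{U}=\{\mathbf{u}\mid\mathbf{A}\mathbf{u}\le\mathbf{c}\}$ with $\mathbf{A}$ a constant matrix and $\mathbf{c}$ a constant vector such that $\mathcal{U}$ is compact; vector inequalities are elementwise, and $\mathrm{Int}$ denotes interior. $\mathcal{P}=\{1,\dots,N_h\}$, $\mathcal{X}_p=\{\mathbf{x}\mid h_p(\mathbf{x})\ge 0\}$, $\mathcal{X}_c=\bigcup_{p=1}^{N_h}\mathcal{X}_p$. $L_{\mathbf{f}}h=\frac{\partial h}{\partial\mathbf{x}}\mathbf{f}$, $L_{\mathbf{G}}h=\frac{\partial h}{\partial\mathbf{x}}\mathbf{G}$. $\kappa>0$ is a fixed constant. Switching controller: $\mathbf{u}(t)=\mathbf{k}_{\sigma(t)}(\mathbf{x}(t))$ with switching signal $\sigma:[0,\infty)\to\mathcal{P}$, where $\mathbf{k}_p(\mathbf{x})$ is the minimizer over $\mathbf{u}$ of $\frac12\mathbf{u}^T\mathbf{H}(\mathbf{x})\mathbf{u}+\mathbf{c}^T(\mathbf{x})\mathbf{u}$ subject to $L_{\mathbf{f}}h_p(\mathbf{x})+L_{\mathbf{G}}h_p(\mathbf{x})\mathbf{u}\ge-\kappa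 h_p(\mathbf{x})$ and $\mathbf{A}\mathbf{u}\le\mathbf{c}$, with $\mathbf{H}(\mathbf{x})\succ0$ for all $\mathbf{x}\in\mathcal{X}$ (the cost vector $\mathbf{c}(\mathbf{x})$ is distinct from the constant vector $\mathbf{c}$). $\mathbf{x}(t)$ denotes the closed-loop trajectory. Standing assumption: there is a compact region of interest $\mathcal{R}\subseteq\mathcal{X}$ in which the switching controller is used while $\mathbf{x}(t)\in\mathcal{R}$; $\mathcal{R}$ is large enough that once $\mathbf{x}(t)$ enters $\mathcal{R}$ it stays in $\mathcal{R}$ for at least a length of time $T>0$. Switching Strategy II: let $\eta_h,\eta_l,\tau$ be positive constants with $\eta_h>\eta_l$. (i) For all $t\in[0,\tau)$, $\sigma(t)=p_0$, where $p_0\in\mathcal{P}$ is such that $h_{p_0}(\mathbf{x}(0))\ge0$. (ii) $\sigma(t)$ switches from $p\in\mathcal{P}$ to another $p'\in\mathcal{P}$ at time $t$ if $h_p(\mathbf{x}(t))\le\eta_l$ and $h_{p'}(\mathbf{x}(t))\ge\eta_h$. *)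

theory Defs
  imports "HOL-Analysis.Analysis"
begin

definition grad :: "(real ^ 'n \<Rightarrow> real) \<Rightarrow> real ^ 'n \<Rightarrow> real ^ 'n" where
  "grad h x = (\<chi> i. frechet_derivative h (at x) (axis i 1))"

definition lie_field :: "(real ^ 'n \<Rightarrow> real ^ 'n) \<Rightarrow> (real ^ 'n \<Rightarrow> real) \<Rightarrow> real ^ 'n \<Rightarrow> real" where
  "lie_field f h x = grad h x \<bullet> f x"

definition lie_matrix ::
    "(real ^ 'n \<Rightarrow> real ^ 'm ^ 'n) \<Rightarrow> (real ^ 'n \<Rightarrow> real) \<Rightarrow> real ^ 'n \<Rightarrow> real ^ 'm" where
  "lie_matrix G h x = grad h x v* G x"

text \<open>The order on vectors is the componentwise one.\<close>

definition control_set :: "real ^ 'm ^ 'k \<Rightarrow> real ^ 'k \<Rightarrow> (real ^ 'm) set" where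
  "control_set A c = {u. A *v u \<le> c}"

definition pos_definite :: "real ^ 'm ^ 'm \<Rightarrow> bool" where
  "pos_definite M \<longleftrightarrow> transpose M = M \<and> (\<forall>v. v \<noteq> 0 \<longrightarrow> 0 < v \<bullet> (M *v v))"

definition qp_feasible ::
    "(real ^ 'n \<Rightarrow> real ^ 'n) \<Rightarrow> (real ^ 'n \<Rightarrow> real ^ 'm ^ 'n) \<Rightarrow> real ^ 'm ^ 'k \<Rightarrow> real ^ 'k \<Rightarrow>
     real \<Rightarrow> (real ^ 'n \<Rightarrow> real) \<Rightarrow> real ^ 'n \<Rightarrow> (real ^ 'm) set" where
  "qp_feasible f G A c \<kappa> h x =
     {u. lie_field f h x + lie_matrix G h x \<bullet> u \<ge> - \<kappa> * h x \<and> A *v u \<le> c}"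

definition qp_cost ::
    "(real ^ 'n \<Rightarrow> real ^ 'm ^ 'm) \<Rightarrow> (real ^ 'n \<Rightarrow> real ^ 'm) \<Rightarrow> real ^ 'n \<Rightarrow> real ^ 'm \<Rightarrow> real" where
  "qp_cost H q x u = 1 / 2 * (u \<bullet> (H x *v u)) + q x \<bullet> u"

text \<open>Where the quadratic program is infeasible the controller has an unspecified value, about
  which nothing is assumed.\<close>

definition qp_control ::
    "(real ^ 'n \<Rightarrow> real ^ 'n) \<Rightarrow> (real ^ 'n \<Rightarrow> real ^ 'm ^ 'n) \<Rightarrow> real ^ 'm ^ 'k \<Rightarrow> real ^ 'k \<Rightarrow>
     real \<Rightarrow> (real ^ 'n \<Rightarrow> real ^ 'm ^ 'm) \<Rightarrow> (real ^ 'n \<Rightarrow> real ^ 'm) \<Rightarrow>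
     (real ^ 'n \<Rightarrow> real) \<Rightarrow> real ^ 'n \<Rightarrow> real ^ 'm" where
  "qp_control f G A c \<kappa> H q h x = arg_min_on (qp_cost H q x) (qp_feasible f G A c \<kappa> h x)"

text \<open>A solution of the switched differential equation on the time interval \<open>J\<close> is a solution of
  the integral equation.  This covers Caratheodory solutions and continuous functions satisfying
  the differential equation outside a countable set of times (such as the switching times), and
  it makes sense before anything is known about the regularity of \<open>\<sigma>\<close>.\<close>

definition closed_loop_on ::
    "real set \<Rightarrow> (real ^ 'n \<Rightarrow> real ^ 'n) \<Rightarrow> (real ^ 'n \<Rightarrow> real ^ 'm ^ 'n) \<Rightarrow>
     (nat \<Rightarrow> real ^ 'n \<Rightarrow> real ^ 'm) \<Rightarrow> (real \<Rightarrow> nat) \<Rightarrow> (real \<Rightarrow> real ^ 'n) \<Rightarrow> bool" where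
  "closed_loop_on J f G k \<sigma> x \<longleftrightarrow>
     (\<forall>t\<in>J. ((\<lambda>s. f (x s) + G (x s) *v k (\<sigma> s) (x s)) has_integral (x t - x 0)) {0..t})"

definition switch_condition ::
    "(nat \<Rightarrow> real ^ 'n \<Rightarrow> real) \<Rightarrow> real \<Rightarrow> real \<Rightarrow> (real \<Rightarrow> real ^ 'n) \<Rightarrow> nat \<Rightarrow> nat \<Rightarrow> real \<Rightarrow> bool" where
  "switch_condition h \<eta>\<^sub>h \<eta>\<^sub>l x p p' t \<longleftrightarrow> h p (x t) \<le> \<eta>\<^sub>l \<and> h p' (x t) \<ge> \<eta>\<^sub>h"

text \<open>The strategy as an event rule that presupposes no regularity of \<open>\<sigma>\<close>, in particular no left
  limits and no isolated switching times.  From any time \<open>s\<close> on, the mode \<open>\<sigma> s\<close> stays active up to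
  the first later time \<open>t \<ge> \<tau>\<close> at which the switching condition holds for it and some target; at
  that \<open>t\<close> the new value \<open>\<sigma> t\<close> is one of the admissible targets.  So switches occur when, and only
  when, the condition holds, and if several targets qualify any of them may be taken.\<close>

definition follows_strategy_II ::
    "real set \<Rightarrow> nat \<Rightarrow> (nat \<Rightarrow> real ^ 'n \<Rightarrow> real) \<Rightarrow> real \<Rightarrow> real \<Rightarrow> real \<Rightarrow>
     (real \<Rightarrow> real ^ 'n) \<Rightarrow> (real \<Rightarrow> nat) \<Rightarrow> bool" where
  "follows_strategy_II J N h \<eta>\<^sub>h \<eta>\<^sub>l \<tau> x \<sigma> \<longleftrightarrow>
     (\<exists>p\<^sub>0\<in>{1..N}. h p\<^sub>0 (x 0) \<ge> 0 \<and> (\<forall>t\<in>J. t < \<tau> \<longrightarrow> \<sigma> t = p\<^sub>0)) \<and>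
     (\<forall>s\<in>J. \<forall>t\<in>J. s < t \<longrightarrow>
        (\<forall>r. s < r \<and> r < t \<and> \<tau> \<le> r \<longrightarrow> \<not> (\<exists>p'\<in>{1..N}. switch_condition h \<eta>\<^sub>h \<eta>\<^sub>l x (\<sigma> s) p' r)) \<longrightarrow>
        (if \<tau> \<le> t \<and> (\<exists>p'\<in>{1..N}. switch_condition h \<eta>\<^sub>h \<eta>\<^sub>l x (\<sigma> s) p' t)
         then switch_condition h \<eta>\<^sub>h \<eta>\<^sub>l x (\<sigma> s) (\<sigma> t) t
         else \<sigma> t = \<sigma> s))"

definition right_continuous_on :: "real set \<Rightarrow> (real \<Rightarrow> nat) \<Rightarrow> bool" where
  "right_continuous_on J \<sigma> \<longleftrightarrow> (\<forall>t\<in>J. continuous (at t within J \<inter> {t..}) \<sigma>)"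

definition piecewise_constant_on :: "real set \<Rightarrow> (real \<Rightarrow> nat) \<Rightarrow> bool" where
  "piecewise_constant_on S \<sigma> \<longleftrightarrow>
     (\<exists>D. finite D \<and> (\<forall>C\<in>components (S - D). \<sigma> constant_on C))"

text \<open>Since \<open>nat\<close> is discrete, the switches are the discontinuities.\<close>

definition switch_times :: "real set \<Rightarrow> (real \<Rightarrow> nat) \<Rightarrow> real set" where
  "switch_times S \<sigma> = {t\<in>S. \<not> continuous (at t within S) \<sigma>}"

end

theory Submission
  imports Defs
begin

text \<open>
  While mode \<open>p\<close> is in force, \<open>h p\<close> cannot become negative.  Hypothesis \<open>C2_1\<close> is a strict form of the
  constraint of the quadratic program, so by continuity the program stays feasible a little
  outside \<open>{y. h p y \<ge> 0}\<close>; there its constraint says that \<open>h p\<close> grows along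
  the trajectory at least at the rate \<open>- \<kappa> * h p > 0\<close>, which makes leaving the set impossible
  (\<open>barrier_forward_invariant\<close>).  Without the margin the program could be
  infeasible just outside the set, where the control would then be arbitrary.  As \<open>x\<close> only solves an integral
  equation, monotonicity of \<open>h p\<close> along it is obtained without differentiating \<open>x\<close>
  (\<open>nondecreasing_along_solution\<close>).

  A switch happens to a mode \<open>p'\<close> with \<open>h p' \<ge> \<eta>\<^sub>h > 0\<close>, so nonnegativity of the active function is
  passed on from mode to mode.  Mode \<open>p'\<close> in turn is left only after \<open>h p'\<close> has fallen from \<open>\<eta>\<^sub>h\<close> to
  \<open>\<eta>\<^sub>l\<close>.  On a compact time interval the functions \<open>h p \<circ> x\<close> are uniformly continuous, so this takes
  a time bounded below, and only finitely many switches fit into the interval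
  (\<open>finite_switching_schedule\<close>).  Safety and the finiteness of the schedule are proved in one
  induction over the switches.  Right continuity and piecewise constancy are read off the schedule, and \<open>C2_1\<close> at the now known point of
  \<open>{y. h p y \<ge> 0}\<close> gives the strict inequality, because \<open>\<epsilon> > 0\<close>.
\<close>

section \<open>Gradients of polynomials\<close>

lemma real_polynomial_function_C1:
  fixes h :: "'a::euclidean_space \<Rightarrow> real"
  assumes "real_polynomial_function h"
  shows "\<exists>D. (\<forall>y. (h has_derivative D y) (at y)) \<and> (\<forall>v. continuous_on UNIV (\<lambda>y. D y v))"
  using assms
proof (induction h rule: real_polynomial_function.induct)
  case (linear h)
  then have "\<forall>y. (h has_derivative h) (at y)"
    by (simp add: bounded_linear_imp_has_derivative)
  then show ?case by (intro exI[of _ "\<lambda>y. h"]) auto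
next
  case (const c)
  show ?case by (intro exI[of _ "\<lambda>y v. 0"]) auto
next
  case (add h1 h2)
  then obtain D1 D2 where
    "\<forall>y. (h1 has_derivative D1 y) (at y)" "\<forall>v. continuous_on UNIV (\<lambda>y. D1 y v)"
    "\<forall>y. (h2 has_derivative D2 y) (at y)" "\<forall>v. continuous_on UNIV (\<lambda>y. D2 y v)"
    by blast
  then show ?case
    by (intro exI[of _ "\<lambda>y v. D1 y v + D2 y v"]) (auto intro!: derivative_intros continuous_intros)
next
  case (mult h1 h2)
  then obtain D1 D2 where D:
    "\<forall>y. (h1 has_derivative D1 y) (at y)" "\<forall>v. continuous_on UNIV (\<lambda>y. D1 y v)"
    "\<forall>y. (h2 has_derivative D2 y) (at y)" "\<forall>v. continuous_on UNIV (\<lambda>y. D2 y v)"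
    by blast
  have "continuous_on UNIV h1" "continuous_on UNIV h2"
    using mult.hyps by (auto intro!: continuous_at_imp_continuous_on continuous_real_polymonial_function)
  with D show ?case
    by (intro exI[of _ "\<lambda>y v. h1 y * D2 y v + D1 y v * h2 y"])
      (auto intro!: continuous_intros has_derivative_mult)
qed

lemma polynomial_function_grad:
  fixes h :: "real ^ 'n \<Rightarrow> real"
  assumes "polynomial_function h"
  shows has_derivative_grad: "(h has_derivative (\<lambda>v. grad h y \<bullet> v)) (at y)"
    and continuous_on_grad: "continuous_on UNIV (grad h)"
proof -
  obtain D where D: "\<And>y. (h has_derivative D y) (at y)"
      and cont: "\<And>v. continuous_on UNIV (\<lambda>y. D y v)"
    using real_polynomial_function_C1 assms real_polynomial_function_eq by metis
  have fd: "frechet_derivative h (at y) = D y" for y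
    using D frechet_derivative_at by metis
  have grad_eq: "grad h = (\<lambda>y. \<chi> i. D y (axis i 1))"
    by (simp add: grad_def fd fun_eq_iff)
  show "continuous_on UNIV (grad h)"
    unfolding grad_eq by (intro continuous_intros cont)
  have "D y v = grad h y \<bullet> v" for v
  proof -
    have lin: "linear (D y)" using D has_derivative_linear by blast
    have "D y v = D y (\<Sum>i\<in>UNIV. (v $ i) *\<^sub>R axis i 1)"
      using basis_expansion[of v] by (simp add: scalar_mult_eq_scaleR)
    also have "\<dots> = (\<Sum>i\<in>UNIV. (v $ i) * D y (axis i 1))"
      by (simp add: linear_sum[OF lin] linear_scale[OF lin])
    finally show ?thesis by (simp add: grad_eq inner_vec_def mult.commute)
  qed
  then show "(h has_derivative (\<lambda>v. grad h y \<bullet> v)) (at y)"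
    using D[of y] by (metis (no_types, lifting) ext)
qed

lemma continuous_on_matrix_vector_mult [continuous_intros]:
  fixes M :: "'a::topological_space \<Rightarrow> real ^ 'm ^ 'n"
  assumes "continuous_on S M" "continuous_on S v"
  shows "continuous_on S (\<lambda>y. M y *v v y)"
  unfolding matrix_vector_mult_def by (intro continuous_intros assms)

lemma lie_derivative_along_control:
  "lie_field f h y + lie_matrix G h y \<bullet> u = grad h y \<bullet> (f y + G y *v u)"
  by (simp add: lie_field_def lie_matrix_def dot_lmul_matrix inner_add_right)

section \<open>Functions along solutions of integral equations\<close>

text \<open>The right-hand side is only integrable in time, so the chain rule along \<open>x\<close> is not available
  at any particular time.  The proof shows instead that \<open>h \<circ> x\<close> decreases at an arbitrarily small
  rate \<open>\<eta>\<close> at most: on a short interval the gradient is almost constant and can be moved into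
  the integral, and short intervals are glued by bisection.\<close>

lemma nondecreasing_along_solution:
  fixes x :: "real \<Rightarrow> 'a::euclidean_space" and h :: "'a \<Rightarrow> real"
  assumes "a \<le> b"
    and sol: "\<And>s t. a \<le> s \<Longrightarrow> s \<le> t \<Longrightarrow> t \<le> b \<Longrightarrow> (g has_integral (x t - x s)) {s..t}"
    and bnd: "\<And>r. r \<in> {a..b} \<Longrightarrow> norm (g r) \<le> B"
    and deriv: "\<And>y. (h has_derivative (\<lambda>v. D y \<bullet> v)) (at y)"
    and cont: "continuous_on UNIV D"
    and nonneg: "\<And>r. r \<in> {a..b} \<Longrightarrow> D (x r) \<bullet> g r \<ge> 0"
  shows "h (x a) \<le> h (x b)"
proof -
  have B: "B \<ge> 0" using bnd[of a] \<open>a \<le> b\<close> norm_ge_zero by (metis atLeastAtMost_iff order_refl order_trans)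
  have lip: "norm (x t - x s) \<le> B * (t - s)" if "a \<le> s" "s \<le> t" "t \<le> b" for s t
    using has_integral_bound_real[OF B _ sol[OF that], of "{}"] bnd that by auto
  have slow: "h (x b) - h (x a) \<ge> - \<eta> * (b - a)" if "\<eta> > 0" for \<eta>
  proof -
    have "a \<le> a \<and> a \<le> b \<and> b \<le> b \<longrightarrow> h (x b) - h (x a) \<ge> - \<eta> * (b - a)"
      using \<open>a \<le> b\<close>
    proof (rule Bolzano[where P = "\<lambda>s t. a \<le> s \<and> s \<le> t \<and> t \<le> b \<longrightarrow> h (x t) - h (x s) \<ge> - \<eta> * (t - s)"])
      fix s r t
      assume "a \<le> s \<and> s \<le> r \<and> r \<le> b \<longrightarrow> h (x r) - h (x s) \<ge> - \<eta> * (r - s)"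
        "a \<le> r \<and> r \<le> t \<and> t \<le> b \<longrightarrow> h (x t) - h (x r) \<ge> - \<eta> * (t - r)" "s \<le> r" "r \<le> t"
      then show "a \<le> s \<and> s \<le> t \<and> t \<le> b \<longrightarrow> h (x t) - h (x s) \<ge> - \<eta> * (t - s)"
        by (auto simp: algebra_simps)
    next
      fix r0 assume r0: "a \<le> r0" "r0 \<le> b"
      define y where "y = x r0"
      \<comment> \<open>Each of the two approximations, of \<open>h\<close> by its linear part and of \<open>D (x r)\<close> by \<open>D y\<close>, costs at
        most the rate \<open>e * B\<close>.\<close>
      define e where "e = \<eta> / (2 * (B + 1))"
      have e: "e > 0" "2 * (e * B) \<le> \<eta>"
        using \<open>\<eta> > 0\<close> B by (auto simp: e_def field_simps)
      obtain d1 where d1: "d1 > 0"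
          "\<And>z. norm (z - y) < d1 \<Longrightarrow> norm (h z - h y - D y \<bullet> (z - y)) \<le> e * norm (z - y)"
        using deriv[of y] e(1) unfolding has_derivative_at_alt by blast
      obtain d2 where d2: "d2 > 0" "\<And>z. norm (z - y) < d2 \<Longrightarrow> norm (D z - D y) < e"
        using cont e(1) unfolding continuous_on_iff dist_norm by (metis UNIV_I)
      define d where "d = min d1 d2 / (B + 1)"
      have d: "d > 0" "(B + 1) * d = min d1 d2" using d1 d2 B by (auto simp: d_def)
      have near: "norm (x r - y) \<le> B * \<bar>r - r0\<bar>" if "r \<in> {a..b}" for r
        using lip[of r r0] lip[of r0 r] that r0
        by (cases "r \<le> r0") (auto simp: y_def norm_minus_commute)
      have close: "norm (x r - y) < min d1 d2" if "r \<in> {a..b}" "\<bar>r - r0\<bar> < d" for r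
      proof -
        have "norm (x r - y) \<le> B * d"
          using near[OF that(1)] mult_left_mono[OF less_imp_le[OF that(2)] B] by linarith
        then show ?thesis using d by (simp only: distrib_right)
      qed
      have "h (x t) - h (x s) \<ge> - \<eta> * (t - s)"
        if st: "s \<le> r0" "r0 \<le> t" "t - s < d" "a \<le> s" "t \<le> b" for s t
      proof -
        have hs: "\<bar>h (x r) - h y - D y \<bullet> (x r - y)\<bar> \<le> e * (B * \<bar>r - r0\<bar>)" if "r \<in> {s, t}" for r
        proof -
          have "\<bar>h (x r) - h y - D y \<bullet> (x r - y)\<bar> \<le> e * norm (x r - y)"
            using d1(2)[of "x r"] close[of r] that st by auto
          also have "\<dots> \<le> e * (B * \<bar>r - r0\<bar>)"
            using near[of r] that st e(1) by (intro mult_left_mono) auto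
          finally show ?thesis .
        qed
        have int: "((\<lambda>r. D y \<bullet> g r) has_integral D y \<bullet> (x t - x s)) {s..t}"
          using has_integral_linear[OF sol[of s t] bounded_linear_inner_right[of "D y"]] st
          by (simp add: o_def)
        have low: "D y \<bullet> g r \<ge> - (e * B)" if "r \<in> {s..t}" for r
        proof -
          have "\<bar>(D (x r) - D y) \<bullet> g r\<bar> \<le> norm (D (x r) - D y) * norm (g r)"
            by (rule Cauchy_Schwarz_ineq2)
          also have "\<dots> \<le> e * B"
            using d2(2)[of "x r"] close[of r] bnd[of r] that st e(1)
            by (intro mult_mono) auto
          finally have "\<bar>(D (x r) - D y) \<bullet> g r\<bar> \<le> e * B" .
          moreover have "D (x r) \<bullet> g r \<ge> 0" using nonneg that st by auto
          ultimately show ?thesis by (simp add: inner_diff_left)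
        qed
        have "((\<lambda>r. - (e * B)) has_integral (t - s) *\<^sub>R (- (e * B))) {s..t}"
          using has_integral_const_real[of "- (e * B)" s t] st by simp
        then have "(t - s) *\<^sub>R (- (e * B)) \<le> D y \<bullet> (x t - x s)"
          using has_integral_le int low by blast
        moreover have "h (x t) - h (x s) \<ge> D y \<bullet> (x t - x s) - e * (B * (t - r0)) - e * (B * (r0 - s))"
          using hs[of s] hs[of t] st by (auto simp: inner_diff_right abs_le_iff)
        ultimately have "h (x t) - h (x s) \<ge> - (2 * (e * B)) * (t - s)"
          by (simp add: algebra_simps)
        moreover have "2 * (e * B) * (t - s) \<le> \<eta> * (t - s)"
          using e(2) st by (intro mult_right_mono) auto
        ultimately show ?thesis by simp
      qed
      then show "\<exists>d>0. \<forall>s t. s \<le> r0 \<and> r0 \<le> t \<and> t - s < d \<longrightarrow>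
          a \<le> s \<and> s \<le> t \<and> t \<le> b \<longrightarrow> h (x t) - h (x s) \<ge> - \<eta> * (t - s)"
        using d(1) by blast
    qed
    then show ?thesis using \<open>a \<le> b\<close> by simp
  qed
  have "h (x a) \<le> h (x b) + e" if "e > 0" for e
  proof (cases "a = b")
    case False
    with \<open>a \<le> b\<close> have "e / (b - a) > 0" "e / (b - a) * (b - a) = e" using that by auto
    then show ?thesis using slow[of "e / (b - a)"] by simp
  qed (use that in simp)
  then show ?thesis by (rule field_le_epsilon)
qed

lemma solution_increment:
  fixes x :: "real \<Rightarrow> 'a::banach"
  assumes "\<And>t. t \<in> {0..b} \<Longrightarrow> (g has_integral (x t - x 0)) {0..t}" "0 \<le> s" "s \<le> t" "t \<le> b"
  shows "(g has_integral (x t - x s)) {s..t}"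
proof -
  have t: "(g has_integral (x t - x 0)) {0..t}" and s: "(g has_integral (x s - x 0)) {0..s}"
    using assms by auto
  have "g integrable_on {s..t}"
    using integrable_subinterval_real[OF has_integral_integrable[OF t], of s t] assms by auto
  then obtain i where i: "(g has_integral i) {s..t}" by auto
  have "(g has_integral (x s - x 0 + i)) {0..t}"
    using has_integral_combine[OF _ _ s i] assms by auto
  with t have "x t - x 0 = x s - x 0 + i" by (rule has_integral_unique)
  then have "i = x t - x s" by (simp add: algebra_simps)
  with i show ?thesis by simp
qed

lemma solution_continuous:
  fixes x :: "real \<Rightarrow> 'a::banach"
  assumes "\<And>t. t \<in> {0..b} \<Longrightarrow> (g has_integral (x t - x 0)) {0..t}"
  shows "continuous_on {0..b} x"
proof (cases "0 \<le> b")
  case True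
  then have "continuous_on {0..b} (\<lambda>t. x 0 + integral {0..t} g)"
    using assms[of b] by (intro continuous_intros indefinite_integral_continuous_1) auto
  moreover have "x 0 + integral {0..t} g = x t" if "t \<in> {0..b}" for t
    using integral_unique[OF assms[OF that]] by simp
  ultimately show ?thesis using continuous_on_eq by blast
qed simp

section \<open>The quadratic program and forward invariance\<close>

text \<open>A minimizer exists because the feasible set is a closed part of the compact control set and the
  cost is continuous; the controller is then one of the minimizers.\<close>

lemma qp_control_feasible:
  fixes G :: "real ^ 'n \<Rightarrow> real ^ 'm ^ 'n"
  assumes "compact (control_set A c)" "qp_feasible f G A c \<kappa> h y \<noteq> {}"
  shows "qp_control f G A c \<kappa> H q h y \<in> qp_feasible f G A c \<kappa> h y"
proof -
  let ?F = "qp_feasible f G A c \<kappa> h y"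
  have "?F = {u. - \<kappa> * h y \<le> lie_field f h y + lie_matrix G h y \<bullet> u} \<inter> control_set A c"
    by (auto simp: qp_feasible_def control_set_def)
  moreover have "closed {u. - \<kappa> * h y \<le> lie_field f h y + lie_matrix G h y \<bullet> u}"
    by (intro closed_Collect_le continuous_intros)
  ultimately have "compact ?F" using assms(1) by (simp add: closed_Int_compact)
  moreover have "continuous_on ?F (qp_cost H q y)"
    unfolding qp_cost_def by (intro continuous_intros)
  ultimately obtain u where u: "u \<in> ?F" "\<forall>v\<in>?F. qp_cost H q y u \<le> qp_cost H q y v"
    using continuous_attains_inf assms(2) by blast
  then have "is_arg_min (qp_cost H q y) (\<lambda>u. u \<in> ?F) u"
    by (simp add: is_arg_min_linorder)
  then have "is_arg_min (qp_cost H q y) (\<lambda>u. u \<in> ?F) (arg_min_on (qp_cost H q y) ?F)"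
    unfolding arg_min_on_def arg_min_def by (rule someI)
  then show ?thesis by (simp add: qp_control_def is_arg_min_def)
qed

text \<open>The strict margin \<open>\<epsilon>\<close> keeps the program feasible slightly outside \<open>{y. h y \<ge> 0}\<close>, and there
  its constraint forces \<open>h\<close> to grow, since \<open>- \<kappa> * h > 0\<close>.  So no trajectory can leave the set: just
  after the last time with \<open>h \<ge> 0\<close> the function \<open>h\<close> would be nondecreasing.\<close>

lemma barrier_forward_invariant:
  fixes x :: "real \<Rightarrow> real ^ 'n" and G :: "real ^ 'n \<Rightarrow> real ^ 'm ^ 'n"
  assumes f: "continuous_on UNIV f" and G: "continuous_on UNIV G" and h: "polynomial_function h"
    and U: "compact (control_set A c)" and "\<kappa> > 0" "\<epsilon> > 0"
    and feas: "\<And>y. h y \<ge> 0 \<Longrightarrow> \<exists>u\<in>control_set A c.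
          lie_field f h y + lie_matrix G h y \<bullet> u + \<kappa> * h y \<ge> \<epsilon>"
    and sol: "\<And>s' t'. s \<le> s' \<Longrightarrow> s' \<le> t' \<Longrightarrow> t' \<le> t \<Longrightarrow> (g has_integral (x t' - x s')) {s'..t'}"
    and cont: "continuous_on {s..t} x"
    and g: "\<And>r. r \<in> {s..<t} \<Longrightarrow> g r = f (x r) + G (x r) *v qp_control f G A c \<kappa> H q h (x r)"
    and start: "h (x s) \<ge> 0" and r: "r \<in> {s..t}"
  shows "h (x r) \<ge> 0"
proof (rule ccontr)
  assume "\<not> h (x r) \<ge> 0"
  then have neg: "h (x r) < 0" by simp
  have hx: "continuous_on {s..t} (\<lambda>r. h (x r))"
    using continuous_on_polymonial_function[OF h] cont
    by (rule continuous_on_compose2) auto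
  define S where "S = {t' \<in> {s..r}. h (x t') \<ge> 0}"
  have "closed S"
    unfolding S_def using r
    by (intro continuous_on_closed_Collect_le continuous_on_const continuous_on_subset[OF hx]) auto
  moreover have "S = S \<inter> {s..r}" by (auto simp: S_def)
  ultimately have "compact S" by (metis closed_Int_compact compact_Icc)
  moreover have "s \<in> S" using start r by (simp add: S_def)
  ultimately obtain t0 where t0: "t0 \<in> S" "\<And>t'. t' \<in> S \<Longrightarrow> t' \<le> t0"
    using compact_attains_sup by (metis empty_iff)
  have "t0 \<noteq> r" using t0(1) neg by (auto simp: S_def)
  then have t0s: "s \<le> t0" "t0 < r" "h (x t0) \<ge> 0" using t0(1) by (auto simp: S_def)
  have after: "h (x t') < 0" if "t0 < t'" "t' \<le> r" for t'
    using t0(2)[of t'] that t0s by (force simp: S_def)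
  obtain u where u: "u \<in> control_set A c"
      "lie_field f h (x t0) + lie_matrix G h (x t0) \<bullet> u + \<kappa> * h (x t0) \<ge> \<epsilon>"
    using feas t0s by blast
  define slack where "slack y = grad h y \<bullet> (f y + G y *v u) + \<kappa> * h y" for y
  have "continuous_on UNIV slack"
    unfolding slack_def
    by (intro continuous_intros continuous_on_grad f G h continuous_on_polymonial_function)
  then have "continuous_on {s..t} (\<lambda>r. slack (x r))"
    using cont by (rule continuous_on_compose2) auto
  moreover have "t0 \<in> {s..t}" using t0s r by simp
  moreover have "slack (x t0) > 0"
    using u(2) \<open>\<epsilon> > 0\<close> by (simp add: slack_def lie_derivative_along_control)
  ultimately obtain d where d: "d > 0"
      "\<And>r'. r' \<in> {s..t} \<Longrightarrow> dist r' t0 < d \<Longrightarrow> dist (slack (x r')) (slack (x t0)) < slack (x t0)"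
    unfolding continuous_on_iff by blast
  define t1 where "t1 = min (t0 + d / 2) ((t0 + r) / 2)"
  have t1: "t0 < t1" "t1 < r" "t1 < t0 + d" using d t0s by (auto simp: t1_def min_def)
  have in_F: "qp_control f G A c \<kappa> H q h (x r') \<in> qp_feasible f G A c \<kappa> h (x r')"
    if "r' \<in> {t0..t1}" for r'
  proof (rule qp_control_feasible[OF U])
    have "slack (x r') > 0"
    proof -
      have "r' \<in> {s..t}" "dist r' t0 < d" using that t1 t0s r by (auto simp: dist_real_def)
      from d(2)[OF this] show ?thesis unfolding dist_real_def by linarith
    qed
    then have "u \<in> qp_feasible f G A c \<kappa> h (x r')"
      using u(1) by (simp add: qp_feasible_def slack_def control_set_def lie_derivative_along_control)
    then show "qp_feasible f G A c \<kappa> h (x r') \<noteq> {}" by blast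
  qed
  \<comment> \<open>A bound for the velocity near \<open>t0\<close>: states and controls range over compact sets.\<close>
  define V where "V = (\<lambda>(y, u). f y + G y *v u) ` (x ` {t0..t1} \<times> control_set A c)"
  have "compact (x ` {t0..t1})"
    using t0s t1 r by (intro compact_continuous_image continuous_on_subset[OF cont]) auto
  moreover have "continuous_on S' (\<lambda>(y, u). f y + G y *v u)" for S'
    unfolding case_prod_unfold
    by (intro continuous_intros continuous_on_compose2[OF f] continuous_on_compose2[OF G]) auto
  ultimately have "compact V"
    unfolding V_def using U compact_continuous_image compact_Times by blast
  then obtain B where B: "\<forall>v\<in>V. norm v \<le> B"
    using compact_imp_bounded[of V] unfolding bounded_iff by blast
  have "h (x t0) \<le> h (x t1)"
  proof (rule nondecreasing_along_solution[where D = "grad h" and g = g])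
    fix r' assume r': "r' \<in> {t0..t1}"
    then have gr: "g r' = f (x r') + G (x r') *v qp_control f G A c \<kappa> H q h (x r')"
      using g t0s t1 r by auto
    show "norm (g r') \<le> B"
      using B r' in_F[OF r'] unfolding gr V_def by (auto simp: qp_feasible_def control_set_def)
    have constr: "grad h (x r') \<bullet> g r' \<ge> - \<kappa> * h (x r')"
      using in_F[OF r'] unfolding gr by (simp add: qp_feasible_def lie_derivative_along_control)
    show "grad h (x r') \<bullet> g r' \<ge> 0"
    proof (cases "r' = t0")
      case True
      \<comment> \<open>By continuity, since \<open>h\<close> is negative right after \<open>t0\<close>.\<close>
      have "h (x t0) \<le> 0"
      proof (rule ccontr)
        assume "\<not> h (x t0) \<le> 0"
        then have "0 < h (x t0)" by simp
        then obtain d' where d': "d' > 0"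
            "\<And>r'. r' \<in> {s..t} \<Longrightarrow> dist r' t0 < d' \<Longrightarrow> dist (h (x r')) (h (x t0)) < h (x t0)"
          using hx \<open>t0 \<in> {s..t}\<close> unfolding continuous_on_iff by blast
        define r1 where "r1 = min (t0 + d' / 2) r"
        have r1: "t0 < r1" "r1 \<le> r" "r1 < t0 + d'" using d' t0s by (auto simp: r1_def min_def)
        have "r1 \<in> {s..t}" "dist r1 t0 < d'" using r1 t0s r by (auto simp: dist_real_def)
        from d'(2)[OF this] show False
          using after[OF r1(1,2)] unfolding dist_real_def by linarith
      qed
      then have "- \<kappa> * h (x r') \<ge> 0" using True \<open>\<kappa> > 0\<close> by (simp add: mult_le_0_iff)
      with constr show ?thesis by simp
    next
      case False
      then have "- \<kappa> * h (x r') \<ge> 0" using after[of r'] r' t1 \<open>\<kappa> > 0\<close> by (simp add: mult_le_0_iff)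
      with constr show ?thesis by simp
    qed
  qed (use sol t0s t1 r has_derivative_grad[OF h] continuous_on_grad[OF h] in auto)
  with after[of t1] t1 t0s show False by simp
qed

section \<open>The switching schedule\<close>

text \<open>The interval \<open>{r<..r'}\<close> is open at \<open>r\<close> and closed at \<open>r'\<close> because a jump takes effect at its own
  time; this is what makes \<open>\<sigma>\<close> right continuous.\<close>

definition jumps_only_at :: "real set \<Rightarrow> real set \<Rightarrow> (real \<Rightarrow> 'a) \<Rightarrow> bool" where
  "jumps_only_at D S \<sigma> \<longleftrightarrow>
     finite D \<and> (\<forall>r\<in>S. \<forall>r'\<in>S. r \<le> r' \<and> D \<inter> {r<..r'} = {} \<longrightarrow> \<sigma> r' = \<sigma> r)"

lemma jumps_only_at_extend:
  fixes \<sigma> :: "real \<Rightarrow> 'a"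
  assumes D: "jumps_only_at D {a..<t} \<sigma>" and "a \<le> t"
    and S: "S \<subseteq> {a..}" "\<And>r. r \<in> S \<Longrightarrow> t \<le> r \<Longrightarrow> \<sigma> r = \<sigma> t"
  shows "jumps_only_at (insert t D) S \<sigma>"
  unfolding jumps_only_at_def
proof (intro conjI ballI impI)
  show "finite (insert t D)" using D by (simp add: jumps_only_at_def)
  fix r r' assume r: "r \<in> S" "r' \<in> S" and no_jump: "r \<le> r' \<and> insert t D \<inter> {r<..r'} = {}"
  consider "r' < t" | "t \<le> r" using no_jump by fastforce
  then show "\<sigma> r' = \<sigma> r"
  proof cases
    case 1
    moreover have "r \<in> {a..<t}" "r' \<in> {a..<t}" using 1 r S(1) no_jump by auto
    ultimately show ?thesis using D no_jump unfolding jumps_only_at_def by blast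
  next
    case 2
    then show ?thesis using S(2)[OF r(1)] S(2)[OF r(2)] no_jump by simp
  qed
qed

lemma continuous_within_if_locally_constant:
  fixes \<sigma> :: "real \<Rightarrow> 'a::topological_space"
  assumes "e > 0" "\<And>r. r \<in> S \<Longrightarrow> \<bar>r - t\<bar> < e \<Longrightarrow> \<sigma> r = \<sigma> t"
  shows "continuous (at t within S) \<sigma>"
proof -
  have "\<forall>\<^sub>F r in at t within S. \<sigma> r = \<sigma> t"
    unfolding eventually_at using assms by (auto simp: dist_real_def intro!: exI[of _ e])
  then show ?thesis unfolding continuous_within by (rule tendsto_eventually)
qed

lemma finite_isolating_radius:
  fixes t :: real
  assumes "finite D"
  shows "\<exists>e>0. \<forall>r\<in>D - {t}. e \<le> \<bar>r - t\<bar>"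
  using finite_set_avoid[OF assms, of t] by (auto simp: dist_real_def abs_minus_commute)

lemma piecewise_constant_on_if_jumps:
  assumes "jumps_only_at D {0..b} \<sigma>"
  shows "piecewise_constant_on {0..b} \<sigma>"
  unfolding piecewise_constant_on_def
proof (intro exI[of _ D] conjI ballI)
  show "finite D" using assms by (simp add: jumps_only_at_def)
  fix C assume C: "C \<in> components ({0..b} - D)"
  have eq: "\<sigma> r' = \<sigma> r" if "r \<in> C" "r' \<in> C" "r \<le> r'" for r r'
  proof -
    have "{r..r'} \<subseteq> C"
      using in_components_connected[OF C] that by (simp add: connected_contains_Icc)
    then have "{r..r'} \<subseteq> {0..b} - D" using in_components_subset[OF C] by blast
    then have between: "z \<in> {0..b} \<and> z \<notin> D" if "r \<le> z" "z \<le> r'" for z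
      using that by auto
    then have "D \<inter> {r<..r'} = {}" by fastforce
    moreover have "r \<in> {0..b}" "r' \<in> {0..b}" using between \<open>r \<le> r'\<close> by blast+
    ultimately show ?thesis using assms that(3) unfolding jumps_only_at_def by blast
  qed
  have "\<sigma> r = \<sigma> r'" if "r \<in> C" "r' \<in> C" for r r'
    using eq[of r r'] eq[of r' r] that by linarith
  then show "\<sigma> constant_on C" unfolding constant_on_def by blast
qed

lemma switch_times_subset_jumps:
  assumes "jumps_only_at D {0..b} \<sigma>"
  shows "switch_times {0..b} \<sigma> \<subseteq> D"
proof
  fix t assume t: "t \<in> switch_times {0..b} \<sigma>"
  show "t \<in> D"
  proof (rule ccontr)
    assume "t \<notin> D"
    obtain e where e: "e > 0" "\<forall>r\<in>D - {t}. e \<le> \<bar>r - t\<bar>"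
      using finite_isolating_radius assms unfolding jumps_only_at_def by blast
    have "\<sigma> r = \<sigma> t" if r: "r \<in> {0..b}" "\<bar>r - t\<bar> < e" for r
    proof -
      have "D \<inter> {min r t<..max r t} = {}"
      proof (rule ccontr)
        assume "D \<inter> {min r t<..max r t} \<noteq> {}"
        then obtain z where "z \<in> D" "min r t < z" "z \<le> max r t" by auto
        moreover from this have "e \<le> \<bar>z - t\<bar>" using e(2) \<open>t \<notin> D\<close> by auto
        ultimately show False using r(2) by linarith
      qed
      moreover have "min r t \<in> {0..b}" "max r t \<in> {0..b}"
        using t r(1) by (auto simp: switch_times_def)
      ultimately have "\<sigma> (max r t) = \<sigma> (min r t)"
        using assms unfolding jumps_only_at_def by (meson min.cobounded1 max.cobounded1 order_trans)
      then show ?thesis by (cases "r \<le> t") (auto simp: min_def max_def split: if_splits)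
    qed
    then have "continuous (at t within {0..b}) \<sigma>"
      using continuous_within_if_locally_constant[OF e(1)] by blast
    then show False using t by (simp add: switch_times_def)
  qed
qed

lemma right_continuous_if_jumps:
  assumes D: "jumps_only_at D {0..b} \<sigma>" and t: "0 \<le> t" "t < b"
  shows "continuous (at t within J \<inter> {t..}) \<sigma>"
proof -
  obtain e where e: "e > 0" "\<forall>r\<in>D - {t}. e \<le> \<bar>r - t\<bar>"
    using finite_isolating_radius D unfolding jumps_only_at_def by blast
  show ?thesis
  proof (rule continuous_within_if_locally_constant)
    show "min e (b - t) > 0" using e(1) t by simp
    fix r assume r: "r \<in> J \<inter> {t..}" "\<bar>r - t\<bar> < min e (b - t)"
    have "D \<inter> {t<..r} = {}" using e(2) r by force
    moreover have "t \<in> {0..b}" "r \<in> {0..b}" "t \<le> r" using r t by auto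
    ultimately show "\<sigma> r = \<sigma> t" using D unfolding jumps_only_at_def by blast
  qed
qed

text \<open>The strategy speaks of the interval up to the next trigger; that a first trigger exists is
  compactness.  The side condition ensures that \<open>s\<close> itself is no trigger, so that the first one is
  later than \<open>s\<close>.\<close>

lemma first_trigger:
  assumes strat: "follows_strategy_II J N h \<eta>\<^sub>h \<eta>\<^sub>l \<tau> x \<sigma>"
    and J: "{0..b} \<subseteq> J"
    and cont: "\<And>p. p \<in> {1..N} \<Longrightarrow> continuous_on {0..b} (\<lambda>t. h p (x t))"
    and mode: "\<sigma> s \<in> {1..N}"
    and s: "s \<in> {0..b}" "s < \<tau> \<or> h (\<sigma> s) (x s) > \<eta>\<^sub>l" and "\<tau> > 0"
  obtains (never) "\<forall>r\<in>{s..b}. \<sigma> r = \<sigma> s"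
  | (switch) t where "s < t" "t \<le> b" "\<tau> \<le> t" "\<forall>r\<in>{s..<t}. \<sigma> r = \<sigma> s"
      "switch_condition h \<eta>\<^sub>h \<eta>\<^sub>l x (\<sigma> s) (\<sigma> t) t"
proof -
  define trig where "trig r \<longleftrightarrow> \<tau> \<le> r \<and> (\<exists>p'\<in>{1..N}. switch_condition h \<eta>\<^sub>h \<eta>\<^sub>l x (\<sigma> s) p' r)" for r
  have rule: "if trig t then switch_condition h \<eta>\<^sub>h \<eta>\<^sub>l x (\<sigma> s) (\<sigma> t) t else \<sigma> t = \<sigma> s"
    if "s < t" "t \<le> b" "\<And>r. s < r \<Longrightarrow> r < t \<Longrightarrow> \<not> trig r" for t
  proof -
    have "s \<in> J" "t \<in> J" using that s(1) J by auto
    then show ?thesis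
      using strat that(1,3) unfolding follows_strategy_II_def trig_def by blast
  qed
  define S where "S = {r \<in> {max s \<tau>..b}. trig r}"
  have trig_iff: "trig r \<longleftrightarrow> h (\<sigma> s) (x r) \<le> \<eta>\<^sub>l \<and> (\<exists>p'\<in>{1..N}. \<eta>\<^sub>h \<le> h p' (x r))"
    if "r \<in> {max s \<tau>..b}" for r
    using that by (auto simp: trig_def switch_condition_def)
  have sub: "{max s \<tau>..b} \<subseteq> {0..b}" using s(1) by auto
  have "S = {r \<in> {max s \<tau>..b}. h (\<sigma> s) (x r) \<le> \<eta>\<^sub>l} \<inter> (\<Union>p'\<in>{1..N}. {r \<in> {max s \<tau>..b}. \<eta>\<^sub>h \<le> h p' (x r)})"
    using trig_iff unfolding S_def by fastforce
  also have "closed \<dots>"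
    by (intro closed_Int closed_UN continuous_on_closed_Collect_le finite_atLeastAtMost closed_real_atLeastAtMost
      continuous_on_const ballI continuous_on_subset[OF cont sub] mode)
  finally have "closed S" .
  moreover have "S = S \<inter> {max s \<tau>..b}" by (auto simp: S_def)
  ultimately have "compact S" by (metis closed_Int_compact compact_Icc)
  show thesis
  proof (cases "S = {}")
    case True
    then have no: "\<not> trig r" if "s \<le> r" "r \<le> b" for r
      using that by (auto simp: S_def trig_def)
    have "\<sigma> r = \<sigma> s" if "r \<in> {s..b}" for r
    proof (cases "r = s")
      case False
      then have r: "s < r" "r \<le> b" using that by auto
      then show ?thesis using rule[OF r] no by auto
    qed simp
    then show thesis using never by blast
  next
    case False
    with \<open>compact S\<close> obtain t where t: "t \<in> S" "\<And>r. r \<in> S \<Longrightarrow> t \<le> r"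
      using compact_attains_inf by metis
    have no: "\<not> trig r" if "s \<le> r" "r < t" for r
      using that t(1) t(2)[of r] by (auto simp: S_def trig_def)
    have tr: "trig t" "t \<in> {max s \<tau>..b}" using t(1) by (auto simp: S_def)
    have "t \<noteq> s" using s(2) tr by (auto simp: trig_def switch_condition_def)
    then have st: "s < t" "t \<le> b" "\<tau> \<le> t" using tr by auto
    have "\<sigma> r = \<sigma> s" if "r \<in> {s..<t}" for r
    proof (cases "r = s")
      case False
      then have r: "s < r" "r \<le> b" "r < t" using that st by auto
      then show ?thesis using rule[OF r(1,2)] no[of r] no by auto
    qed simp
    moreover have "switch_condition h \<eta>\<^sub>h \<eta>\<^sub>l x (\<sigma> s) (\<sigma> t) t"
      using rule[OF st(1,2)] no tr(1) by auto
    ultimately show thesis using switch st by blast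
  qed
qed

text \<open>With \<open>\<eta> = \<eta>\<^sub>h - \<eta>\<^sub>l\<close> the time \<open>\<delta>\<close> bounds from below how long a mode entered at level \<open>\<eta>\<^sub>h\<close> and
  left at level \<open>\<eta>\<^sub>l\<close> is in force.\<close>

lemma hysteresis_dwell_time:
  fixes \<phi> :: "nat \<Rightarrow> real \<Rightarrow> real"
  assumes "\<And>p. p \<in> {1..N} \<Longrightarrow> continuous_on {0..b} (\<phi> p)" and "\<eta> > 0"
  shows "\<exists>\<delta>>0. \<forall>p\<in>{1..N}. \<forall>s\<in>{0..b}. \<forall>t\<in>{0..b}. \<bar>t - s\<bar> < \<delta> \<longrightarrow> \<bar>\<phi> p t - \<phi> p s\<bar> < \<eta>"
proof -
  have "\<exists>d>0. \<forall>s\<in>{0..b}. \<forall>t\<in>{0..b}. \<bar>t - s\<bar> < d \<longrightarrow> \<bar>\<phi> p t - \<phi> p s\<bar> < \<eta>" if "p \<in> {1..N}" for p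
    using compact_uniformly_continuous[OF assms(1)[OF that] compact_Icc] \<open>\<eta> > 0\<close>
    unfolding uniformly_continuous_on_def dist_real_def by blast
  then obtain d where d: "\<And>p. p \<in> {1..N} \<Longrightarrow> d p > 0"
      "\<And>p s t. p \<in> {1..N} \<Longrightarrow> s \<in> {0..b} \<Longrightarrow> t \<in> {0..b} \<Longrightarrow> \<bar>t - s\<bar> < d p \<Longrightarrow> \<bar>\<phi> p t - \<phi> p s\<bar> < \<eta>"
    by metis
  define \<delta> where "\<delta> = Min (insert 1 (d ` {1..N}))"
  have "\<delta> > 0" unfolding \<delta>_def using d(1) by (subst Min_gr_iff) auto
  moreover have "\<delta> \<le> d p" if "p \<in> {1..N}" for p
    unfolding \<delta>_def using that by (intro Min_le) auto
  ultimately show ?thesis using d(2) by (meson less_le_trans)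
qed

text \<open>Passing from one switch to the next costs at least a fixed time \<open>\<delta>\<close>, hence the passage ends after
  finitely many switches.  Invariance of the active set \<open>{y. h p y \<ge> 0}\<close> while mode \<open>p\<close> is in force
  is a hypothesis here; a switch preserves nonnegativity because the new mode starts at level
  \<open>\<eta>\<^sub>h > 0\<close>.\<close>

lemma finite_switching_schedule:
  assumes strat: "follows_strategy_II J N h \<eta>\<^sub>h \<eta>\<^sub>l \<tau> x \<sigma>"
    and J: "{0..b} \<subseteq> J" and "0 \<le> b"
    and cont: "\<And>p. p \<in> {1..N} \<Longrightarrow> continuous_on {0..b} (\<lambda>t. h p (x t))"
    and mode: "\<And>t. t \<in> J \<Longrightarrow> \<sigma> t \<in> {1..N}"
    and pos: "\<eta>\<^sub>l > 0" "\<eta>\<^sub>h > \<eta>\<^sub>l" "\<tau> > 0"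
    and invariant: "\<And>s t r. 0 \<le> s \<Longrightarrow> t \<le> b \<Longrightarrow> \<forall>r'\<in>{s..<t}. \<sigma> r' = \<sigma> s \<Longrightarrow> h (\<sigma> s) (x s) \<ge> 0 \<Longrightarrow>
        r \<in> {s..t} \<Longrightarrow> h (\<sigma> s) (x r) \<ge> 0"
  shows "\<exists>D. jumps_only_at D {0..b} \<sigma> \<and> (\<forall>r\<in>{0..b}. h (\<sigma> r) (x r) \<ge> 0)"
proof -
  have "\<eta>\<^sub>h - \<eta>\<^sub>l > 0" using pos by simp
  from hysteresis_dwell_time[where \<phi> = "\<lambda>p t. h p (x t)" and N = N, OF cont this]
  obtain \<delta>' where \<delta>': "\<delta>' > 0" "\<forall>p\<in>{1..N}. \<forall>s\<in>{0..b}. \<forall>t\<in>{0..b}. \<bar>t - s\<bar> < \<delta>' \<longrightarrow>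
      \<bar>h p (x t) - h p (x s)\<bar> < \<eta>\<^sub>h - \<eta>\<^sub>l"
    by blast
  \<comment> \<open>The initial mode need not start at level \<open>\<eta>\<^sub>h\<close>; it is in force for a time \<open>\<tau>\<close> by the strategy.\<close>
  define \<delta> where "\<delta> = min \<delta>' \<tau>"
  have \<delta>: "\<delta> > 0" "\<delta> \<le> \<tau>" "\<delta> \<le> \<delta>'" using \<delta>' pos by (auto simp: \<delta>_def)
  let ?done = "\<exists>D. jumps_only_at D {0..b} \<sigma> \<and> (\<forall>r\<in>{0..b}. h (\<sigma> r) (x r) \<ge> 0)"
  \<comment> \<open>The time \<open>t\<close> is that of the \<open>n\<close>-th switch, or \<open>0\<close> for \<open>n = 0\<close>.\<close>
  have "?done \<or> (\<exists>t D. t \<in> {0..b} \<and> real n * \<delta> \<le> t \<and> (t = 0 \<or> \<eta>\<^sub>h \<le> h (\<sigma> t) (x t)) \<and>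
      0 \<le> h (\<sigma> t) (x t) \<and> jumps_only_at D {0..<t} \<sigma> \<and> (\<forall>r\<in>{0..<t}. h (\<sigma> r) (x r) \<ge> 0))" for n
  proof (induction n)
    case 0
    have "h (\<sigma> 0) (x 0) \<ge> 0"
      using strat J \<open>0 \<le> b\<close> pos(3) unfolding follows_strategy_II_def
      by (metis atLeastAtMost_iff order_refl subsetD)
    then show ?case
      using \<open>0 \<le> b\<close> by (intro disjI2 exI[of _ 0] exI[of _ "{}"]) (auto simp: jumps_only_at_def)
  next
    case (Suc n)
    show ?case
    proof (cases ?done)
      case False
      with Suc obtain t D where t: "t \<in> {0..b}" "real n * \<delta> \<le> t" "t = 0 \<or> \<eta>\<^sub>h \<le> h (\<sigma> t) (x t)"
          "0 \<le> h (\<sigma> t) (x t)" and D: "jumps_only_at D {0..<t} \<sigma>" and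
          safe: "\<forall>r\<in>{0..<t}. h (\<sigma> r) (x r) \<ge> 0"
        by blast
      have extend: "jumps_only_at (insert t D) S \<sigma> \<and> (\<forall>r\<in>S. h (\<sigma> r) (x r) \<ge> 0)"
        if "S \<subseteq> {0..t'}" "t' \<le> b" "\<forall>r\<in>{t..<t'}. \<sigma> r = \<sigma> t" "\<forall>r\<in>S. t \<le> r \<longrightarrow> \<sigma> r = \<sigma> t" for S t'
      proof (intro conjI ballI)
        show "jumps_only_at (insert t D) S \<sigma>"
          using that t(1) by (intro jumps_only_at_extend[OF D]) auto
        fix r assume r: "r \<in> S"
        show "h (\<sigma> r) (x r) \<ge> 0"
        proof (cases "r < t")
          case True
          moreover have "0 \<le> r" using r that(1) by auto
          ultimately show ?thesis using safe by simp
        next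
          case False
          then have "r \<in> {t..t'}" "0 \<le> t" using r that(1) t(1) by auto
          then have "h (\<sigma> t) (x r) \<ge> 0"
            using invariant[OF _ that(2,3) t(4)] by blast
          moreover have "\<sigma> r = \<sigma> t" using that(4) r False by simp
          ultimately show ?thesis by simp
        qed
      qed
      have mode_t: "\<sigma> t \<in> {1..N}" using mode J t(1) by blast
      have not_trig: "t < \<tau> \<or> h (\<sigma> t) (x t) > \<eta>\<^sub>l" using t(3) pos by auto
      show ?thesis
      proof (rule first_trigger[OF strat J cont mode_t t(1) not_trig pos(3)])
        assume never: "\<forall>r\<in>{t..b}. \<sigma> r = \<sigma> t"
        have "\<forall>r\<in>{t..<b}. \<sigma> r = \<sigma> t" "\<forall>r\<in>{0..b}. t \<le> r \<longrightarrow> \<sigma> r = \<sigma> t"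
          by (intro ballI impI never[rule_format]; simp)+
        with extend[OF order_refl order_refl] have ?done by blast
        with False show ?thesis ..
      next
        fix t'
        assume switch: "t < t'" "t' \<le> b" "\<tau> \<le> t'" "\<forall>r\<in>{t..<t'}. \<sigma> r = \<sigma> t"
          "switch_condition h \<eta>\<^sub>h \<eta>\<^sub>l x (\<sigma> t) (\<sigma> t') t'"
        have t': "t' \<in> {0..b}" using switch(1,2) t(1) by auto
        have levels: "h (\<sigma> t) (x t') \<le> \<eta>\<^sub>l" "\<eta>\<^sub>h \<le> h (\<sigma> t') (x t')"
          using switch(5) by (auto simp: switch_condition_def)
        have "t + \<delta> \<le> t'"
        proof (cases "t = 0")
          case True
          then show ?thesis using switch(3) \<delta>(2) by simp
        next
          case False
          then have "\<not> \<bar>h (\<sigma> t) (x t') - h (\<sigma> t) (x t)\<bar> < \<eta>\<^sub>h - \<eta>\<^sub>l"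
            using t(3) levels(1) by auto
          then have "\<not> \<bar>t' - t\<bar> < \<delta>'" using \<delta>'(2) mode_t t(1) t' by blast
          then show ?thesis using switch(1) \<delta>(3) by simp
        qed
        then have "real (Suc n) * \<delta> \<le> t'" using t(2) by (simp add: algebra_simps)
        moreover have "jumps_only_at (insert t D) {0..<t'} \<sigma> \<and> (\<forall>r\<in>{0..<t'}. h (\<sigma> r) (x r) \<ge> 0)"
        proof (rule extend)
          show "{0..<t'} \<subseteq> {0..t'}" by auto
          show "\<forall>r\<in>{0..<t'}. t \<le> r \<longrightarrow> \<sigma> r = \<sigma> t"
            by (intro ballI impI switch(4)[rule_format]) simp
        qed (rule switch)+
        moreover have "0 \<le> h (\<sigma> t') (x t')" using levels(2) pos by linarith
        ultimately show ?thesis using t' levels(2) by blast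
      qed assumption+
    qed simp
  qed
  note unless_done = this
  obtain n where n: "b < real n * \<delta>" using reals_Archimedean3[OF \<delta>(1)] by blast
  have "\<not> real n * \<delta> \<le> t" if "t \<in> {0..b}" for t using that n by simp
  with unless_done[of n] show ?thesis by blast
qed

section \<open>Safety and finite switching\<close>

theorem theorem3:
  fixes f :: "real ^ 'n \<Rightarrow> real ^ 'n"
    and G :: "real ^ 'n \<Rightarrow> real ^ 'm ^ 'n"
    and A :: "real ^ 'm ^ 'k" and c :: "real ^ 'k"
    and H :: "real ^ 'n \<Rightarrow> real ^ 'm ^ 'm" and q :: "real ^ 'n \<Rightarrow> real ^ 'm"
    and X R :: "(real ^ 'n) set"
    and N :: nat and h :: "nat \<Rightarrow> real ^ 'n \<Rightarrow> real"
    and \<kappa> \<epsilon> \<eta>\<^sub>h \<eta>\<^sub>l \<tau> T :: real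
    and J :: "real set"
    and x :: "real \<Rightarrow> real ^ 'n" and \<sigma> :: "real \<Rightarrow> nat"
  assumes poly_f: "polynomial_function f"
    and poly_G: "polynomial_function G"
    and poly_h: "\<And>p. p \<in> {1..N} \<Longrightarrow> polynomial_function (h p)"
    and U_compact: "compact (control_set A c)"
    and H_pos: "\<And>y. y \<in> X \<Longrightarrow> pos_definite (H y)"
    and positive: "\<kappa> > 0" "\<epsilon> > 0" "\<eta>\<^sub>l > 0" "\<eta>\<^sub>h > \<eta>\<^sub>l" "\<tau> > 0"
    and C2_1: "\<And>p y. p \<in> {1..N} \<Longrightarrow> h p y \<ge> 0 \<Longrightarrow>
        \<exists>u\<in>interior (control_set A c).
          lie_field f (h p) y + lie_matrix G (h p) y \<bullet> u + \<kappa> * h p y \<ge> \<epsilon>"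
    \<comment> \<open>\<open>J\<close> is the time interval on which the switching controller is in use, e.g. \<open>{0..}\<close>\<close>
    and J: "is_interval J" "0 \<in> J" "J \<subseteq> {0..}"
    and region: "compact R" "R \<subseteq> X" "T > 0" "{0..T} \<subseteq> J" "\<And>t. t \<in> {0..T} \<Longrightarrow> x t \<in> R"
    and state: "\<And>t. t \<in> J \<Longrightarrow> x t \<in> X"
    and signal: "\<And>t. t \<in> J \<Longrightarrow> \<sigma> t \<in> {1..N}"
    and trajectory: "closed_loop_on J f G (\<lambda>p. qp_control f G A c \<kappa> H q (h p)) \<sigma> x"
    and strategy: "follows_strategy_II J N h \<eta>\<^sub>h \<eta>\<^sub>l \<tau> x \<sigma>"
  shows "right_continuous_on J \<sigma> \<and>
      (\<forall>b>0. {0..b} \<subseteq> J \<longrightarrow>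
         piecewise_constant_on {0..b} \<sigma> \<and> finite (switch_times {0..b} \<sigma>)) \<and>
      (\<forall>t\<in>J. h (\<sigma> t) (x t) \<ge> 0 \<and>
         (\<exists>u\<in>interior (control_set A c).
            lie_field f (h (\<sigma> t)) (x t) + lie_matrix G (h (\<sigma> t)) (x t) \<bullet> u
              > - \<kappa> * h (\<sigma> t) (x t)))"
proof -
  let ?g = "\<lambda>s. f (x s) + G (x s) *v qp_control f G A c \<kappa> H q (h (\<sigma> s)) (x s)"
  have schedule: "\<exists>D. jumps_only_at D {0..b} \<sigma> \<and> (\<forall>r\<in>{0..b}. h (\<sigma> r) (x r) \<ge> 0)"
    if b: "0 \<le> b" "{0..b} \<subseteq> J" for b
  proof (rule finite_switching_schedule[OF strategy b(2,1) _ signal positive(3-5)])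
    have sol0: "(?g has_integral (x t - x 0)) {0..t}" if "t \<in> {0..b}" for t
      using trajectory that b(2) unfolding closed_loop_on_def by blast
    have cont: "continuous_on {0..b} x" using sol0 by (rule solution_continuous)
    show "continuous_on {0..b} (\<lambda>t. h p (x t))" if "p \<in> {1..N}" for p
      using continuous_on_polymonial_function[OF poly_h[OF that]] cont
      by (rule continuous_on_compose2) auto
    show "h (\<sigma> s) (x r) \<ge> 0"
      if st: "0 \<le> s" "t \<le> b" "\<forall>r'\<in>{s..<t}. \<sigma> r' = \<sigma> s" and start: "h (\<sigma> s) (x s) \<ge> 0"
        and r: "r \<in> {s..t}" for s t r
    proof (rule barrier_forward_invariant[where h = "h (\<sigma> s)" and g = ?g and s = s and t = t])
      have "s \<in> J" using b(2) st r by auto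
      then have mode: "\<sigma> s \<in> {1..N}" by (rule signal)
      show "polynomial_function (h (\<sigma> s))" using poly_h mode by blast
      show "\<exists>u\<in>control_set A c. lie_field f (h (\<sigma> s)) y + lie_matrix G (h (\<sigma> s)) y \<bullet> u
          + \<kappa> * h (\<sigma> s) y \<ge> \<epsilon>" if "h (\<sigma> s) y \<ge> 0" for y
        using C2_1[OF mode that] interior_subset by blast
      show "(?g has_integral (x t' - x s')) {s'..t'}" if "s \<le> s'" "s' \<le> t'" "t' \<le> t" for s' t'
        using that st by (intro solution_increment[OF sol0]) auto
      show "continuous_on {s..t} x" using st by (intro continuous_on_subset[OF cont]) auto
      show "?g r' = f (x r') + G (x r') *v qp_control f G A c \<kappa> H q (h (\<sigma> s)) (x r')"
        if "r' \<in> {s..<t}" for r'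
        using bspec[OF st(3) that] by (rule arg_cong)
      show "continuous_on UNIV f" "continuous_on UNIV G"
        by (rule continuous_on_polymonial_function, rule poly_f poly_G)+
    qed (rule U_compact positive start r)+
  qed
  have Icc: "{0..b} \<subseteq> J" if "b \<in> J" for b
    using J(1,2) that unfolding is_interval_1 by (meson atLeastAtMost_iff subsetI)
  have safe: "h (\<sigma> t) (x t) \<ge> 0" if "t \<in> J" for t
  proof -
    have "0 \<le> t" using that J(3) by auto
    with schedule[OF this Icc[OF that]] show ?thesis by auto
  qed
  have "continuous (at t within J \<inter> {t..}) \<sigma>" if t: "t \<in> J" for t
  proof (cases "\<exists>b\<in>J. t < b")
    case True
    then obtain b where b: "b \<in> J" "t < b" by blast
    have "0 \<le> t" using t J(3) by auto
    then obtain D where "jumps_only_at D {0..b} \<sigma>" using schedule[OF _ Icc[OF b(1)]] b(2) by auto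
    then show ?thesis using \<open>0 \<le> t\<close> b(2) by (rule right_continuous_if_jumps)
  next
    \<comment> \<open>At the right end of \<open>J\<close> there is nothing to the right.\<close>
    case False
    then have "J \<inter> {t..} = {t}" using t by force
    then show ?thesis using continuous_within_if_locally_constant[of 1 "{t}" t \<sigma>] by simp
  qed
  moreover have "piecewise_constant_on {0..b} \<sigma> \<and> finite (switch_times {0..b} \<sigma>)"
    if b: "b > 0" "{0..b} \<subseteq> J" for b
  proof -
    obtain D where D: "jumps_only_at D {0..b} \<sigma>" using schedule[of b] b by auto
    then have "finite D" by (simp add: jumps_only_at_def)
    then have "finite (switch_times {0..b} \<sigma>)"
      by (rule finite_subset[OF switch_times_subset_jumps[OF D]])
    with piecewise_constant_on_if_jumps[OF D] show ?thesis ..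
  qed
  moreover have "\<exists>u\<in>interior (control_set A c).
      lie_field f (h (\<sigma> t)) (x t) + lie_matrix G (h (\<sigma> t)) (x t) \<bullet> u > - \<kappa> * h (\<sigma> t) (x t)"
    if t: "t \<in> J" for t
    using C2_1[OF signal[OF t] safe[OF t]] positive(2) by force
  ultimately show ?thesis
    using safe unfolding right_continuous_on_def by blast
qed

end
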